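(* Let $S$ be a regular semigroup which is also a topological semigroup. Let $\nu$ be a continuous norm on $S$. If the set $$N=\{x\in S:\nu(x)\neq 0\}$$ is not closed in $S$, then $S$ is not a topological regular semigroup.
   Context: A norm on a semigroup $S$ is a function $\nu:S\to\mathbb R_{\ge 0}$ such that $\nu(ab)\le\nu(a)\nu(b)$ for all $a,b\in S$. (No other condition is required.) An inverse of an element $x$ of a semigroup $S$ is an element $y\in S$ with $x=xyx$ and $y=yxy$; $V(x)$ denotes the set of all inverses of $x$. A semigroup is regular if for every $x \in S$ there is $y\in S$ with $x=xyx$ (equivalently, $V(x)\ne\emptyset$ for every $x$). A topological semigroup is a semigroup $S$ equipped with a topology such that the product map $S\times S\to S$ is continuous, where $S\times S$ has the product topology. (No separation axiom is assumed.) For a regular semigroup $S$, $V$ is viewed as a multiple map (set-valued map) from $S$ to $S$, $x\mapsto V(x)$. For $A\subseteq S$ put $V(A)=\{y\in S: y\in V(x)\text{ for some }x\in A\}$. The multiple map $V$ is said to be open if $V(A)$ is open in $S$ for every open set $A\subseteq S$. A topological regular semigroup is a topological semigroup $S$ that is also a regular semigroup and for which the multiple map $V:S\to S$ is open. *)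

theory Defs
  imports "HOL-Analysis.Analysis"
begin

text \<open>
  Semigroups have an explicit carrier set \<open>S\<close>, possibly empty. The locale \<open>semigroup\<close> of HOL
  is not used because its operation is associative on the whole type. In a topological
  semigroup the carrier is \<open>topspace T\<close>.
\<close>

locale carrier_semigroup =
  fixes S :: "'a set" and mul :: "'a \<Rightarrow> 'a \<Rightarrow> 'a" (infixl \<open>\<cdot>\<close> 70)
  assumes mul_closed: "\<lbrakk>x \<in> S; y \<in> S\<rbrakk> \<Longrightarrow> x \<cdot> y \<in> S"
    and mul_assoc: "\<lbrakk>x \<in> S; y \<in> S; z \<in> S\<rbrakk> \<Longrightarrow> (x \<cdot> y) \<cdot> z = x \<cdot> (y \<cdot> z)"

locale regular_semigroup = carrier_semigroup +
  assumes regular: "x \<in> S \<Longrightarrow> \<exists>y\<in>S. x = x \<cdot> y \<cdot> x"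

definition inverses :: "'a set \<Rightarrow> ('a \<Rightarrow> 'a \<Rightarrow> 'a) \<Rightarrow> 'a \<Rightarrow> 'a set" where
  "inverses S mul x = {y \<in> S. x = mul (mul x y) x \<and> y = mul (mul y x) y}"

definition inverses_image :: "'a set \<Rightarrow> ('a \<Rightarrow> 'a \<Rightarrow> 'a) \<Rightarrow> 'a set \<Rightarrow> 'a set" where
  "inverses_image S mul A = {y \<in> S. \<exists>x\<in>A. y \<in> inverses S mul x}"

locale topological_semigroup =
  carrier_semigroup "topspace T" mul
  for T :: "'a topology" and mul :: "'a \<Rightarrow> 'a \<Rightarrow> 'a" (infixl \<open>\<cdot>\<close> 70) +
  assumes continuous_mul: "continuous_map (prod_topology T T) T (\<lambda>(x, y). x \<cdot> y)"

locale topological_regular_semigroup =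
  topological_semigroup T mul + regular_semigroup "topspace T" mul
  for T :: "'a topology" and mul :: "'a \<Rightarrow> 'a \<Rightarrow> 'a" (infixl \<open>\<cdot>\<close> 70) +
  assumes open_inverses: "openin T A \<Longrightarrow> openin T (inverses_image (topspace T) mul A)"

definition semigroup_norm :: "'a set \<Rightarrow> ('a \<Rightarrow> 'a \<Rightarrow> 'a) \<Rightarrow> ('a \<Rightarrow> real) \<Rightarrow> bool" where
  "semigroup_norm S mul \<nu> \<longleftrightarrow>
     (\<forall>a\<in>S. 0 \<le> \<nu> a) \<and> (\<forall>a\<in>S. \<forall>b\<in>S. \<nu> (mul a b) \<le> \<nu> a * \<nu> b)"

end

theory Submission
  imports Defs
begin

text \<open>
  If \<open>y\<close> is an inverse of \<open>x\<close>, then \<open>\<nu> x \<le> \<nu> x * \<nu> y * \<nu> x\<close>, so either \<open>\<nu> x = 0\<close> or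
  \<open>\<nu> x * \<nu> y \<ge> 1\<close>. Hence an element with \<open>\<nu> x < 1\<close> has \<open>\<nu> x = 0\<close> exactly when it has an
  inverse of norm less than \<open>1\<close>. With \<open>U = {x. \<nu> x < 1}\<close> the zero set of \<open>\<nu>\<close> is therefore
  \<open>U \<inter> V(U)\<close>, which is open as soon as \<open>\<nu>\<close> is continuous and \<open>V\<close> is open.
\<close>

lemma inverses_sym: "x \<in> S \<Longrightarrow> y \<in> inverses S mul x \<Longrightarrow> x \<in> inverses S mul y"
  by (auto simp: inverses_def)

context regular_semigroup
begin

text \<open>If \<open>x = x y x\<close>, then \<open>y x y\<close> is an inverse of
  \<open>x\<close>.\<close>

lemma inverses_nonempty:
  assumes x: "x \<in> S"
  shows "inverses S (\<cdot>) x \<noteq> {}"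
proof -
  obtain y where y: "y \<in> S" "x \<cdot> y \<cdot> x = x"
    using regular[OF x] by metis
  have xyx: "x \<cdot> (y \<cdot> x) = x"
    using x y by (simp add: mul_assoc)
  \<comment> \<open>In right-associated products \<open>x y x\<close> occurs followed by a further
    factor, so simplification needs the identity with a trailing \<open>z\<close>.\<close>
  have xyxz: "x \<cdot> (y \<cdot> (x \<cdot> z)) = x \<cdot> z" if "z \<in> S" for z
    using x y that by (metis mul_assoc mul_closed)
  have "y \<cdot> x \<cdot> y \<in> inverses S (\<cdot>) x"
    using x y(1) by (simp add: inverses_def mul_closed mul_assoc xyx xyxz)
  then show ?thesis by blast
qed

end

text \<open>Submultiplicativity is applied twice to \<open>x = x y x\<close>.\<close>

lemma semigroup_norm_inverses_le:
  assumes "carrier_semigroup S mul" and "semigroup_norm S mul \<nu>"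
    and "x \<in> S" and "y \<in> inverses S mul x"
  shows "\<nu> x \<le> \<nu> x * \<nu> y * \<nu> x"
proof -
  interpret carrier_semigroup S mul by fact
  have y: "y \<in> S" "x = mul (mul x y) x"
    using assms(4) by (simp_all add: inverses_def)
  have "\<nu> x \<le> \<nu> (mul x y) * \<nu> x"
    using assms(2,3) y mul_closed unfolding semigroup_norm_def by metis
  also have "\<dots> \<le> \<nu> x * \<nu> y * \<nu> x"
    using assms(2,3) y(1) unfolding semigroup_norm_def by (intro mult_right_mono) auto
  finally show ?thesis .
qed

lemma semigroup_norm_zero_set:
  assumes "regular_semigroup S mul" and norm: "semigroup_norm S mul \<nu>"
  defines "U \<equiv> {x \<in> S. \<nu> x < 1}"
  shows "{x \<in> S. \<nu> x = 0} = U \<inter> inverses_image S mul U"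
proof -
  interpret regular_semigroup S mul by fact
  note le = semigroup_norm_inverses_le[OF carrier_semigroup_axioms norm]
  have nonneg: "0 \<le> \<nu> x" if "x \<in> S" for x
    using norm that by (simp add: semigroup_norm_def)
  show ?thesis
  proof (intro equalityI subsetI)
    fix x assume "x \<in> {x \<in> S. \<nu> x = 0}"
    then have x: "x \<in> S" "\<nu> x = 0" by auto
    then obtain y where y: "y \<in> inverses S mul x"
      using inverses_nonempty by blast
    then have yS: "y \<in> S" by (simp add: inverses_def)
    have xy: "x \<in> inverses S mul y"
      using x(1) y by (rule inverses_sym)
    \<comment> \<open>Here \<open>x\<close> is taken as an inverse of \<open>y\<close>: the bound
      \<open>\<nu> y \<le> \<nu> y * \<nu> x * \<nu> y\<close> has right side \<open>0\<close>,
      which puts \<open>y\<close> in \<open>U\<close>.\<close>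
    have "\<nu> y \<le> 0"
      using le[OF yS xy] x(2) by simp
    then show "x \<in> U \<inter> inverses_image S mul U"
      using x yS xy by (auto simp: U_def inverses_image_def)
  next
    fix x assume "x \<in> U \<inter> inverses_image S mul U"
    then obtain y where x: "x \<in> S" "\<nu> x < 1" and y: "y \<in> S" "\<nu> y < 1"
      and xy: "x \<in> inverses S mul y"
      by (auto simp: U_def inverses_image_def)
    have "\<nu> x * \<nu> y < 1"
      using x y nonneg mult_strict_mono'[of "\<nu> x" 1 "\<nu> y" 1] by simp
    \<comment> \<open>In this form a positive \<open>\<nu> x\<close> could be cancelled, giving
      \<open>1 \<le> \<nu> x * \<nu> y\<close>, against the strict bound just shown.\<close>
    moreover have "\<nu> x * 1 \<le> \<nu> x * (\<nu> x * \<nu> y)"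
      using le[OF x(1) inverses_sym[OF y(1) xy]] by (simp add: mult_ac)
    ultimately have "\<not> 0 < \<nu> x"
      by (metis mult_le_cancel_left_pos not_le)
    then show "x \<in> {x \<in> S. \<nu> x = 0}"
      using x(1) nonneg by force
  qed
qed

theorem theorem1:
  fixes T :: "'a topology" and mul :: "'a \<Rightarrow> 'a \<Rightarrow> 'a" and \<nu> :: "'a \<Rightarrow> real"
  assumes "regular_semigroup (topspace T) mul"
    and "topological_semigroup T mul"
    and "semigroup_norm (topspace T) mul \<nu>"
    and "continuous_map T (top_of_set {0..}) \<nu>"
    and "\<not> closedin T {x \<in> topspace T. \<nu> x \<noteq> 0}"
  shows "\<not> topological_regular_semigroup T mul"
proof
  assume "topological_regular_semigroup T mul"
  then interpret topological_regular_semigroup T mul .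
  have "continuous_map T euclideanreal \<nu>"
    using assms(4) by (simp add: continuous_map_in_subtopology)
  then have "openin T {x \<in> topspace T. \<nu> x \<in> {..<1}}"
    by (rule openin_continuous_map_preimage) simp
  \<comment> \<open>The preimage of \<open>{..<1}\<close> is \<open>U\<close>, so \<open>U\<close>
    and its image under \<open>V\<close> are both open.\<close>
  then have "openin T {x \<in> topspace T. \<nu> x = 0}"
    unfolding semigroup_norm_zero_set[OF assms(1,3)]
    by (auto intro!: openin_Int open_inverses)
  moreover have "topspace T - {x \<in> topspace T. \<nu> x \<noteq> 0} = {x \<in> topspace T. \<nu> x = 0}"
    by auto
  ultimately have "closedin T {x \<in> topspace T. \<nu> x \<noteq> 0}"
    by (auto simp: closedin_def)
  with assms(5) show False by contradiction
qed

end
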